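(* Let $P(q)$ be a polynomial. Then $$f_q(n)=\prod_{i=0}^{q-1}\bigl(n+P(i)\bigr)$$ is a two-level polynomial of degree $q$ (that is, with degree function $g(q)=q$) and infinite depth.
   Context: A numerical polynomial is $g\in\mathbb Q[x]$ with $g(q)\in\mathbb Z$ for all $q\in\mathbb Z$. Two-level polynomial: let $g$ be an eventually nonnegative numerical polynomial, $S=\{q\in\mathbb N: g(q)\ge0\}$, and $e:S\to\mathbb N\cup\{-1,\infty\}$. A sequence of polynomials $\{f_q(n)\}_{q\in S}$, with $f_q$ of degree $g(q)$, is a two-level polynomial of degree function $g$ and depth function $e$ if, writing $f_q(n)=\sum_{r=0}^\infty c_r(q)n^{g(q)-r}$ with $c_r(q)=0$ for $r>g(q)$, there exist polynomials $\{\varphi_r(q)\}_{r\ge0}$ such that $c_r(q)=\varphi_r(q)$ for every $q\in S$ and every $r\le e(q)$. Infinite depth means $e(q)=\infty$ for all $q\in S$. The empty product is $1$. *)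

theory Defs
  imports "HOL-Computational_Algebra.Polynomial" "HOL-Library.Extended_Real"
begin

definition numerical_poly :: "rat poly \<Rightarrow> bool" where
  "numerical_poly g \<longleftrightarrow> (\<forall>q::int. poly g (of_int q) \<in> \<int>)"

definition eventually_nonneg :: "rat poly \<Rightarrow> bool" where
  "eventually_nonneg g \<longleftrightarrow> (\<forall>\<^sub>F q in sequentially. 0 \<le> poly g (of_nat q))"

definition nonneg_args :: "rat poly \<Rightarrow> nat set" where
  "nonneg_args g = {q. 0 \<le> poly g (of_nat q)}"

text \<open>The value g(q) as a natural number; the floor and \<open>nat\<close> lose nothing when
  g is numerical and q lies in \<^term>\<open>nonneg_args g\<close>.\<close>

definition nat_value :: "rat poly \<Rightarrow> nat \<Rightarrow> nat" where
  "nat_value g q = nat \<lfloor>poly g (of_nat q)\<rfloor>"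

text \<open>\<open>top_coeff g f r q\<close> is the coefficient c_r(q) of n^(g(q) - r) in f_q(n).\<close>

definition top_coeff :: "rat poly \<Rightarrow> (nat \<Rightarrow> 'a::zero poly) \<Rightarrow> nat \<Rightarrow> nat \<Rightarrow> 'a" where
  "top_coeff g f r q = (if r \<le> nat_value g q then coeff (f q) (nat_value g q - r) else 0)"

definition depth_values :: "ereal set" where
  "depth_values = range (\<lambda>k::nat. ereal (real k)) \<union> {-1, \<infinity>}"

text \<open>The polynomials f_q and the \<open>\<phi> r\<close> have coefficients in an arbitrary field of
  characteristic 0. Families indexed by S are total functions on \<open>nat\<close> whose values outside
  S are irrelevant. The condition \<open>f q \<noteq> 0\<close> is needed because \<open>degree 0 = 0\<close>
  in the library, whereas a polynomial of degree 0 is a nonzero constant.\<close>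

definition two_level_poly ::
  "rat poly \<Rightarrow> (nat \<Rightarrow> ereal) \<Rightarrow> (nat \<Rightarrow> 'a::field_char_0 poly) \<Rightarrow> bool" where
  "two_level_poly g e f \<longleftrightarrow>
     numerical_poly g \<and> eventually_nonneg g \<and>
     (\<forall>q\<in>nonneg_args g. e q \<in> depth_values) \<and>
     (\<forall>q\<in>nonneg_args g. f q \<noteq> 0 \<and> degree (f q) = nat_value g q) \<and>
     (\<exists>\<phi> :: nat \<Rightarrow> 'a poly. \<forall>q\<in>nonneg_args g. \<forall>r. ereal (real r) \<le> e q \<longrightarrow>
        top_coeff g f r q = poly (\<phi> r) (of_nat q))"

end

theory Submission imports Defs begin

text \<open>Multiplying by \<open>n + P(q)\<close> gives the recursion
  \<open>c_(r+1)(q+1) = c_(r+1)(q) + P(q) c_r(q)\<close> for the coefficients counted from the top, so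
  \<open>c_(r+1)(q)\<close> is the sum of \<open>P(i) c_r(i)\<close> over \<open>i < q\<close>. Since \<open>c_0 = 1\<close> and
  indefinite sums of polynomials are polynomials, all \<open>c_r\<close> are polynomials in \<open>q\<close>.\<close>

text \<open>The differences \<open>(i + 1) ^ Suc k - i ^ Suc k\<close>, expanded by the binomial
  theorem, telescope. The term \<open>j = k\<close> is split off so that the identity can be solved
  for the sum of \<open>k\<close>-th powers.\<close>

lemma sum_power_telescope:
  fixes q k :: nat
  shows "(of_nat q :: 'a::comm_ring_1) ^ Suc k
    = of_nat (Suc k) * (\<Sum>i<q. of_nat i ^ k)
      + (\<Sum>j<k. of_nat (Suc k choose j) * (\<Sum>i<q. of_nat i ^ j))"
proof (induction q)
  case 0
  then show ?case by simp
next
  case (Suc q)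
  have "(of_nat (Suc q) :: 'a) ^ Suc k = (of_nat q + 1) ^ Suc k"
    by (simp add: add.commute)
  also have "\<dots> = (\<Sum>j\<le>Suc k. of_nat (Suc k choose j) * of_nat q ^ j)"
    by (simp only: binomial_ring) simp
  also have "\<dots> = (\<Sum>j<k. of_nat (Suc k choose j) * of_nat q ^ j)
      + of_nat (Suc k) * of_nat q ^ k + of_nat q ^ Suc k"
    by (simp only: atMost_Suc lessThan_Suc_atMost [symmetric] lessThan_Suc) simp
  finally show ?case
    unfolding Suc.IH by (simp add: algebra_simps sum.distrib)
qed

lemma sum_power_is_poly:
  "\<exists>R :: 'a::field_char_0 poly. \<forall>q. (\<Sum>i<q. of_nat i ^ k) = poly R (of_nat q)"
proof (induction k rule: less_induct)
  case (less k)
  then obtain S :: "nat \<Rightarrow> 'a poly"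
    where S: "\<And>j q. j < k \<Longrightarrow> (\<Sum>i<q. of_nat i ^ j) = poly (S j) (of_nat q)"
    by metis
  \<comment> \<open>The telescoped identity solved for the \<open>k\<close>-th power sum, with the
    lower sums replaced by \<open>S j\<close>. Characteristic 0 makes \<open>of_nat (Suc k)\<close>
    invertible.\<close>
  define R where "R = smult (inverse (of_nat (Suc k)))
    (monom 1 (Suc k) - (\<Sum>j<k. smult (of_nat (Suc k choose j)) (S j)))"
  have "(\<Sum>i<q. of_nat i ^ k) = poly R (of_nat q)" for q
  proof -
    have "of_nat (Suc k) * (\<Sum>i<q. of_nat i ^ k)
        = (of_nat q :: 'a) ^ Suc k - (\<Sum>j<k. of_nat (Suc k choose j) * poly (S j) (of_nat q))"
      using sum_power_telescope [of q k, where 'a = 'a] by (simp add: S del: power_Suc of_nat_Suc)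
    also have "\<dots> = of_nat (Suc k) * poly R (of_nat q)"
      by (simp add: R_def poly_sum poly_monom del: power_Suc of_nat_Suc)
    finally show ?thesis
      by (simp del: of_nat_Suc)
  qed
  then show ?case by blast
qed

lemma sum_poly_is_poly:
  fixes Q :: "'a::field_char_0 poly"
  shows "\<exists>R. \<forall>q. (\<Sum>i<q. poly Q (of_nat i)) = poly R (of_nat q)"
proof -
  obtain S :: "nat \<Rightarrow> 'a poly"
    where S: "\<And>k q. (\<Sum>i<q. of_nat i ^ k) = poly (S k) (of_nat q)"
    using sum_power_is_poly by metis
  \<comment> \<open>Linearity: expand \<open>Q\<close> in monomials and interchange the two
    sums.\<close>
  have "(\<Sum>i<q. poly Q (of_nat i))
      = poly (\<Sum>k\<le>degree Q. smult (coeff Q k) (S k)) (of_nat q)" for q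
    by (subst poly_altdef, subst sum.swap)
      (simp add: poly_sum S [symmetric] sum_distrib_left)
  then show ?thesis by blast
qed

lemma degree_prod_linear:
  fixes a :: "nat \<Rightarrow> 'a::idom"
  shows "degree (\<Prod>i = 0..<q. [:a i, 1:]) = q"
  by (subst degree_prod_eq_sum_degree) auto

lemma monic_prod_linear:
  fixes a :: "nat \<Rightarrow> 'a::idom"
  shows "coeff (\<Prod>i = 0..<q. [:a i, 1:]) q = 1"
  using lead_coeff_prod [of "\<lambda>i. [:a i, 1:]" "{0..<q}"] by (simp add: degree_prod_linear)

lemma nat_value_identity: "nat_value [:0, 1:] q = q"
  by (simp add: nat_value_def)

lemma top_coeff_prod_linear_Suc:
  fixes a :: "nat \<Rightarrow> 'a::idom"
  defines "F \<equiv> \<lambda>q. \<Prod>i = 0..<q. [:a i, 1:]"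
  shows "top_coeff [:0, 1:] F (Suc r) q = (\<Sum>i<q. a i * top_coeff [:0, 1:] F r i)"
proof (induction q)
  \<comment> \<open>The empty product has degree 0, so its coefficient \<open>Suc r\<close> places
    below the top is 0 by convention, and the summation has no additive constant.\<close>
  case 0
  then show ?case by (simp add: top_coeff_def nat_value_identity)
next
  case (Suc q)
  have "F (Suc q) = smult (a q) (F q) + pCons 0 (F q)"
    by (simp add: F_def mult.commute)
  \<comment> \<open>The boundary cases agree with the convention: for \<open>r = q\<close> the term
    from \<open>pCons 0 (F q)\<close> has constant coefficient 0, and for \<open>r > q\<close>
    everything vanishes.\<close>
  then have "top_coeff [:0, 1:] F (Suc r) (Suc q)
      = top_coeff [:0, 1:] F (Suc r) q + a q * top_coeff [:0, 1:] F r q"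
    by (auto simp: top_coeff_def nat_value_identity coeff_pCons split: nat.split)
      (simp_all add: Suc_diff_Suc less_eq_Suc_le diff_Suc split: nat.splits)
  with Suc.IH show ?case by simp
qed

text \<open>Infinite depth needs one polynomial valid for every \<open>q\<close>, including
  \<open>q < r\<close>, where it has to take the value 0.\<close>

lemma top_coeff_prod_is_poly:
  fixes P :: "'a::field_char_0 poly"
  defines "F \<equiv> \<lambda>q. \<Prod>i = 0..<q. [:poly P (of_nat i), 1:]"
  shows "\<exists>R. \<forall>q. top_coeff [:0, 1:] F r q = poly R (of_nat q)"
proof (induction r)
  case 0
  have "\<forall>q. top_coeff [:0, 1:] F 0 q = poly 1 (of_nat q)"
    by (simp add: F_def top_coeff_def nat_value_identity monic_prod_linear)
  then show ?case by blast
next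
  case (Suc r)
  then obtain R where R: "\<And>q. top_coeff [:0, 1:] F r q = poly R (of_nat q)"
    by blast
  have "top_coeff [:0, 1:] F (Suc r) q = (\<Sum>i<q. poly (P * R) (of_nat i))" for q
    using top_coeff_prod_linear_Suc [of "\<lambda>i. poly P (of_nat i)" r q]
    by (simp add: R [unfolded F_def] F_def)
  then show ?case
    using sum_poly_is_poly [of "P * R"] by simp
qed

theorem proposition1p6:
  fixes P :: "'a::field_char_0 poly"
  shows "two_level_poly [:0, 1:] (\<lambda>q. \<infinity>)
           (\<lambda>q. \<Prod>i = 0..<q. [:poly P (of_nat i), 1:])"
proof -
  obtain \<phi> :: "nat \<Rightarrow> 'a poly" where
    "\<And>r q. top_coeff [:0, 1:] (\<lambda>q. \<Prod>i = 0..<q. [:poly P (of_nat i), 1:]) r q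
      = poly (\<phi> r) (of_nat q)"
    using top_coeff_prod_is_poly by metis
  then show ?thesis
    by (auto simp: two_level_poly_def numerical_poly_def eventually_nonneg_def
        depth_values_def nat_value_identity degree_prod_linear)
qed

end
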